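(* Let $n\ge 2$ and let $\mathcal{T}$ be an $n\times n$ partial symmetric Toeplitz matrix whose pattern $P\subseteq\{1,\dots,n-1\}$ has, for some positive integers $r,k$, one of the following forms: - $P=\{k,2k,\dots,rk\}$; - $P=\{k,2k,\dots,(r-2)k,rk\}$; - $P=\{k,r\}$, where $n\ge k+r$. If $\mathcal{T}$ has a positive semidefinite completion, then $\mathcal{T}$ has a positive semidefinite completion that is Toeplitz.
   Context: All matrices are real. A symmetric $n\times n$ matrix $T$ is Toeplitz if there are reals $t_0,\dots,t_{n-1}$ with $T_{ij}=t_{|i-j|}$ for all $i,j$. For $P\subseteq\{1,\dots,n-1\}$, an $n\times n$ partial symmetric Toeplitz matrix $\mathcal{T}$ with pattern $P$ is given by real data $\{t_k : k\in P\cup\{0\}\}$: the entries $(i,j)$ with $|i-j|\in P\cup\{0\}$ are specified and equal to $t_{|i-j|}$ (the main diagonal is always specified), and all other entries are unspecified. A completion of $\mathcal{T}$ is a symmetric $n\times n$ matrix, not necessarily Toeplitz, that agrees with $\mathcal{T}$ on all specified entries. In the second form, the multiples $k,2k,\dots,(r-2)k$ are absent when $r\le 2$, so that then $P=\{rk\}$. *)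

theory Defs
  imports Complex_Main "Jordan_Normal_Form.Matrix"
begin

definition symmetric_mat :: "real mat \<Rightarrow> bool" where
  "symmetric_mat A \<longleftrightarrow> A\<^sup>T = A"

definition psd_mat :: "real mat \<Rightarrow> bool" where
  "psd_mat A \<longleftrightarrow> square_mat A \<and> symmetric_mat A \<and>
     (\<forall>x \<in> carrier_vec (dim_row A). 0 \<le> x \<bullet> (A *\<^sub>v x))"

text \<open>Absolute difference of two indices; subtraction on \<^typ>\<open>nat\<close> would truncate.
  Indices run from 0 to \<open>n - 1\<close>, which leaves differences unchanged.\<close>

definition index_dist :: "nat \<Rightarrow> nat \<Rightarrow> nat" where
  "index_dist i j = nat \<bar>int i - int j\<bar>"

definition toeplitz_mat :: "real mat \<Rightarrow> bool" where
  "toeplitz_mat T \<longleftrightarrow> square_mat T \<and>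
     (\<exists>t :: nat \<Rightarrow> real. \<forall>i < dim_row T. \<forall>j < dim_row T. T $$ (i, j) = t (index_dist i j))"

text \<open>Unspecified entries are \<^const>\<open>None\<close>. Only the values of \<open>t\<close> on \<open>P \<union> {0}\<close>
  matter. The size \<open>n\<close> enters in the notion of completion, which uses only the entries with
  both indices below \<open>n\<close>.\<close>

definition partial_toeplitz :: "nat set \<Rightarrow> (nat \<Rightarrow> real) \<Rightarrow> nat \<Rightarrow> nat \<Rightarrow> real option" where
  "partial_toeplitz P t i j =
     (if index_dist i j \<in> P \<union> {0} then Some (t (index_dist i j)) else None)"

definition completion :: "nat \<Rightarrow> (nat \<Rightarrow> nat \<Rightarrow> real option) \<Rightarrow> real mat \<Rightarrow> bool" where
  "completion n \<T> A \<longleftrightarrow> A \<in> carrier_mat n n \<and> symmetric_mat A \<and>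
     (\<forall>i < n. \<forall>j < n. \<forall>c. \<T> i j = Some c \<longrightarrow> A $$ (i, j) = c)"

end

theory Submission
  imports Defs
begin

text \<open>
  If all specified distances are multiples of \<open>k\<close>, only the principal submatrix with indices
  \<open>0, k, \<dots>, rk\<close> matters. Averaging it with its flip about the antidiagonal makes it
  Toeplitz also when the distance \<open>(r - 1)k\<close> is unspecified. A positive semidefinite Toeplitz
  sequence can be extended one term at a time, and the extended sequence is spread out by
  inserting zeros at the distances not divisible by \<open>k\<close>.

  For the pattern \<open>{k, r}\<close>, normalise the diagonal to 1 and let \<open>x, y\<close> be the specified
  values. The entries are cosines of angles between unit vectors. The walk that steps \<open>+k\<close>
  below \<open>r\<close> and \<open>-r\<close> from \<open>r\<close> on stays below \<open>k + r\<close> and returns to 0 after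
  \<open>r' = r / gcd k r\<close> steps of the first and \<open>k' = k / gcd k r\<close> steps of the second kind. The
  triangle inequality for angles along it, with signs \<open>\<sigma>, \<tau>\<close> such that
  \<open>\<sigma>^r' \<tau>^k' = -1\<close>, gives \<open>\<pi> \<le> r' arccos (\<sigma> x) + k' arccos (\<tau> y)\<close>. These
  inequalities cut two corners off the square \<open>[-1, 1]\<^sup>2\<close> along arcs of the curve
  \<open>(cos k\<theta>, cos r\<theta>)\<close>, which also passes through the two other corners. Hence
  \<open>(x, y)\<close> lies in the convex hull of the curve, and the corresponding combination of the
  matrices with entries \<open>cos ((i - j)\<theta>)\<close> is the completion.
\<close>

section \<open>Positive semidefinite kernels on finite index sets\<close>

text \<open>Kernels instead of matrices make a change of indices a mere composition. Symmetry is
  stated separately.\<close>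

definition psd_on :: "'a set \<Rightarrow> ('a \<Rightarrow> 'a \<Rightarrow> real) \<Rightarrow> bool" where
  "psd_on I K \<longleftrightarrow> (\<forall>c. 0 \<le> (\<Sum>i\<in>I. \<Sum>j\<in>I. c i * c j * K i j))"

abbreviation toeplitz_psd :: "nat \<Rightarrow> (nat \<Rightarrow> real) \<Rightarrow> bool" where
  "toeplitz_psd n s \<equiv> psd_on {..<n} (\<lambda>i j. s (index_dist i j))"

lemma index_dist_sym: "index_dist i j = index_dist j i"
  by (simp add: index_dist_def)

lemma index_dist_self [simp]: "index_dist i i = 0"
  by (simp add: index_dist_def)

lemma psd_onD: "psd_on I K \<Longrightarrow> 0 \<le> (\<Sum>i\<in>I. \<Sum>j\<in>I. c i * c j * K i j)"
  by (simp add: psd_on_def)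

lemma psd_on_cong:
  assumes "\<And>i j. i \<in> I \<Longrightarrow> j \<in> I \<Longrightarrow> K i j = L i j"
  shows "psd_on I K \<longleftrightarrow> psd_on I L"
  using assms by (simp add: psd_on_def cong: sum.cong)

lemma psd_on_add:
  assumes "psd_on I K" "psd_on I L"
  shows "psd_on I (\<lambda>i j. K i j + L i j)"
  using assms by (simp add: psd_on_def distrib_left sum.distrib)

lemma psd_on_scale:
  assumes "psd_on I K" "0 \<le> a"
  shows "psd_on I (\<lambda>i j. a * K i j)"
proof -
  have "(\<Sum>i\<in>I. \<Sum>j\<in>I. c i * c j * (a * K i j)) = a * (\<Sum>i\<in>I. \<Sum>j\<in>I. c i * c j * K i j)" for c
    by (simp add: sum_distrib_left mult_ac)
  then show ?thesis
    using assms by (simp add: psd_on_def)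
qed

text \<open>The map \<open>\<phi>\<close> may identify indices: coefficients with the same image add
  up to \<open>e\<close>, and the form becomes that of \<open>K\<close> at \<open>e\<close>. This
  covers principal submatrices, reversal of the indices and repeated points.\<close>

lemma psd_on_pullback:
  fixes \<phi> :: "'a \<Rightarrow> 'b"
  assumes psd: "psd_on J K" and fin: "finite I" "finite J" and sub: "\<phi> ` I \<subseteq> J"
  shows "psd_on I (\<lambda>i j. K (\<phi> i) (\<phi> j))"
  unfolding psd_on_def
proof
  fix c :: "'a \<Rightarrow> real"
  define e where "e a = (\<Sum>i | i \<in> I \<and> \<phi> i = a. c i)" for a
  have grp: "(\<Sum>i\<in>I. c i * g (\<phi> i)) = (\<Sum>a\<in>J. e a * g a)" for g :: "'b \<Rightarrow> real"
  proof -
    have "(\<Sum>i\<in>I. c i * g (\<phi> i)) = (\<Sum>a\<in>J. \<Sum>i | i \<in> I \<and> \<phi> i = a. c i * g (\<phi> i))"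
      by (rule sum.group[OF fin sub, symmetric])
    also have "\<dots> = (\<Sum>a\<in>J. e a * g a)"
      unfolding e_def sum_distrib_right by (intro sum.cong) auto
    finally show ?thesis .
  qed
  have "(\<Sum>i\<in>I. \<Sum>j\<in>I. c i * c j * K (\<phi> i) (\<phi> j))
      = (\<Sum>i\<in>I. c i * (\<Sum>j\<in>I. c j * K (\<phi> i) (\<phi> j)))"
    by (simp add: sum_distrib_left mult.assoc)
  also have "\<dots> = (\<Sum>i\<in>I. c i * (\<Sum>b\<in>J. e b * K (\<phi> i) b))"
    by (simp add: grp)
  also have "\<dots> = (\<Sum>a\<in>J. e a * (\<Sum>b\<in>J. e b * K a b))"
    by (rule grp)
  also have "\<dots> = (\<Sum>a\<in>J. \<Sum>b\<in>J. e a * e b * K a b)"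
    by (simp add: sum_distrib_left mult.assoc)
  finally show "0 \<le> (\<Sum>i\<in>I. \<Sum>j\<in>I. c i * c j * K (\<phi> i) (\<phi> j))"
    using psd_onD[OF psd] by simp
qed

lemma psd_on_subset:
  assumes "psd_on J K" "finite J" "I \<subseteq> J"
  shows "psd_on I K"
  using psd_on_pullback[of J K I "\<lambda>i. i"] assms finite_subset by auto

lemma quadratic_form_eq_sum:
  fixes A :: "'a :: comm_semiring_0 mat"
  assumes "A \<in> carrier_mat n n" "x \<in> carrier_vec n"
  shows "x \<bullet> (A *\<^sub>v x) = (\<Sum>i<n. \<Sum>j<n. x $ i * x $ j * A $$ (i, j))"
proof -
  have "x \<bullet> (A *\<^sub>v x) = (\<Sum>i<n. x $ i * (\<Sum>j<n. A $$ (i, j) * x $ j))"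
    using assms by (simp add: scalar_prod_def lessThan_atLeast0)
  also have "\<dots> = (\<Sum>i<n. \<Sum>j<n. x $ i * x $ j * A $$ (i, j))"
    unfolding sum_distrib_left by (intro sum.cong refl) (simp add: mult_ac)
  finally show ?thesis .
qed

lemma psd_mat_iff_psd_on:
  assumes A: "A \<in> carrier_mat n n"
  shows "psd_mat A \<longleftrightarrow> symmetric_mat A \<and> psd_on {..<n} (\<lambda>i j. A $$ (i, j))"
proof -
  have "(\<forall>x\<in>carrier_vec n. 0 \<le> x \<bullet> (A *\<^sub>v x)) \<longleftrightarrow> psd_on {..<n} (\<lambda>i j. A $$ (i, j))"
    (is "?L \<longleftrightarrow> ?R")
  proof
    assume L: ?L
    show ?R
      unfolding psd_on_def
    proof
      fix c :: "nat \<Rightarrow> real"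
      have "vec n c \<in> carrier_vec n"
        by simp
      with L have "0 \<le> vec n c \<bullet> (A *\<^sub>v vec n c)"
        by blast
      then show "0 \<le> (\<Sum>i<n. \<Sum>j<n. c i * c j * A $$ (i, j))"
        by (simp add: quadratic_form_eq_sum[OF A])
    qed
  next
    assume ?R
    then show ?L
      by (simp add: quadratic_form_eq_sum[OF A] psd_onD[of _ _ "vec_index _"])
  qed
  with A show ?thesis
    by (auto simp: psd_mat_def)
qed

lemma toeplitz_completionI:
  assumes psd: "toeplitz_psd n s" and agree: "\<And>d. d \<in> P \<union> {0} \<Longrightarrow> d < n \<Longrightarrow> s d = t d"
  shows "\<exists>A. completion n (partial_toeplitz P t) A \<and> psd_mat A \<and> toeplitz_mat A"
proof -
  define A where "A = mat n n (\<lambda>(i, j). s (index_dist i j))"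
  have car: "A \<in> carrier_mat n n"
    by (simp add: A_def)
  have sym: "symmetric_mat A"
    by (auto simp: symmetric_mat_def A_def index_dist_sym)
  have "psd_on {..<n} (\<lambda>i j. A $$ (i, j))"
    using psd by (subst psd_on_cong[where L = "\<lambda>i j. s (index_dist i j)"]) (auto simp: A_def)
  then have "psd_mat A"
    using sym psd_mat_iff_psd_on[OF car] by blast
  moreover have "completion n (partial_toeplitz P t) A"
  proof -
    have "index_dist i j < n" if "i < n" "j < n" for i j
      using that by (auto simp: index_dist_def)
    then show ?thesis
      using car sym agree
      by (auto simp: completion_def partial_toeplitz_def A_def split: if_splits)
  qed
  moreover have "toeplitz_mat A"
    by (auto simp: toeplitz_mat_def A_def)
  ultimately show ?thesis
    by blast
qed

section \<open>Extending a positive semidefinite Toeplitz sequence\<close>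

text \<open>The mixed terms in \<open>x\<close> and \<open>y\<close> cancel between the two
  forms.\<close>

lemma quadratic_form_rotate:
  fixes K :: "'a \<Rightarrow> 'a \<Rightarrow> real" and I :: "'a set" and a b :: real
  defines "F \<equiv> \<lambda>c. \<Sum>i\<in>I. \<Sum>j\<in>I. c i * c j * K i j"
  shows "F (\<lambda>i. a * x i + b * y i) + F (\<lambda>i. a * y i - b * x i) = (a\<^sup>2 + b\<^sup>2) * (F x + F y)"
proof -
  have "F (\<lambda>i. a * x i + b * y i) + F (\<lambda>i. a * y i - b * x i)
      = (\<Sum>i\<in>I. \<Sum>j\<in>I. (a\<^sup>2 + b\<^sup>2) * (x i * x j * K i j + y i * y j * K i j))"
    unfolding F_def sum.distrib[symmetric]
    by (intro sum.cong refl) (simp add: algebra_simps power2_eq_square)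
  then show ?thesis
    by (simp add: F_def sum.distrib sum_distrib_left[symmetric])
qed

text \<open>The bounds that \<open>F\<close> puts on \<open>z\<close> come from vectors \<open>x, y\<close> for which the products of the
  end coordinates have opposite signs. They are compatible because a rotation of the pair
  \<open>(x, y)\<close> preserves \<open>F x + F y\<close> and can make the last coordinate of one vector and the first
  coordinate of the other vanish simultaneously.\<close>

lemma corner_completion:
  fixes K :: "nat \<Rightarrow> nat \<Rightarrow> real" and m :: nat
  defines "F \<equiv> \<lambda>c. \<Sum>i<m+2. \<Sum>j<m+2. c i * c j * K i j"
  assumes first: "\<And>c. c (Suc m) = 0 \<Longrightarrow> 0 \<le> F c" and last: "\<And>c. c 0 = 0 \<Longrightarrow> 0 \<le> F c"
  shows "\<exists>z. \<forall>c. 0 \<le> F c + 2 * c 0 * c (Suc m) * z"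
proof -
  let ?L = "Suc m"
  have scale: "F (\<lambda>i. a * c i) = a\<^sup>2 * F c" for a c
    unfolding F_def sum_distrib_left
    by (intro sum.cong refl) (simp add: algebra_simps power2_eq_square)
  have pair: "0 \<le> F x + F y" if xy: "x 0 * x ?L + y 0 * y ?L = 0" for x y
  proof (cases "x 0 = 0 \<and> y 0 = 0")
    case True
    then show ?thesis
      using last[of x] last[of y] by simp
  next
    case False
    have "0 \<le> F (\<lambda>i. x 0 * x i + y 0 * y i)"
      by (rule first) (use xy in simp)
    moreover have "0 \<le> F (\<lambda>i. x 0 * y i - y 0 * x i)"
      by (rule last) simp
    ultimately have "0 \<le> ((x 0)\<^sup>2 + (y 0)\<^sup>2) * (F x + F y)"
      using quadratic_form_rotate[where a = "x 0" and b = "y 0" and x = x and y = y and I = "{..<m+2}" and K = K] unfolding F_def by linarith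
    moreover have "0 < (x 0)\<^sup>2 + (y 0)\<^sup>2"
      using False by (simp add: sum_power2_gt_zero_iff)
    ultimately show ?thesis
      by (simp add: zero_le_mult_iff)
  qed
  \<comment> \<open>A vector with \<open>2 * x 0 * x ?L = 1\<close> demands
    \<open>z >= - F x\<close>, one with value \<open>-1\<close> demands \<open>z <= F y\<close>. By
    \<open>pair\<close> every lower bound is at most every upper bound, so \<open>Sup S\<close>
    serves as \<open>z\<close>.\<close>
  define S where "S = {- F x | x. 2 * x 0 * x ?L = 1}"
  have ne: "S \<noteq> {}"
    unfolding S_def by (auto intro!: exI[of _ "\<lambda>i. if i = 0 then 1 else 1 / 2"])
  have ub: "v \<le> F y" if v: "v \<in> S" and y: "2 * y 0 * y ?L = -1" for v y
  proof -
    obtain x where "v = - F x" "2 * x 0 * x ?L = 1"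
      using v unfolding S_def by blast
    then show ?thesis
      using pair[of x y] y by simp
  qed
  have "bdd_above S"
    unfolding bdd_above_def
    by (rule exI[of _ "F (\<lambda>i. if i = 0 then 1 else - 1 / 2)"]) (auto intro!: ub)
  show ?thesis
  proof (intro exI allI)
    fix c :: "nat \<Rightarrow> real"
    \<comment> \<open>Scaling by \<open>1 / sqrt \<bar>p\<bar>\<close> reduces a vector with
      \<open>p \<noteq> 0\<close> to the two normalised kinds.\<close>
    define p where "p = 2 * c 0 * c ?L"
    define e where "e i = 1 / sqrt \<bar>p\<bar> * c i" for i
    have Fe: "\<bar>p\<bar> * F e = F c" if "p \<noteq> 0"
      using scale[of "1 / sqrt \<bar>p\<bar>" c] that unfolding e_def by (simp add: power_divide)
    have e2: "2 * e 0 * e ?L = p / \<bar>p\<bar>" if "p \<noteq> 0"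
      using that unfolding e_def p_def by (simp add: field_simps)
    consider "p = 0" | "p > 0" | "p < 0"
      by linarith
    then have "0 \<le> F c + p * Sup S"
    proof cases
      case 1
      then show ?thesis
        using first[of c] last[of c] by (auto simp: p_def)
    next
      case 2
      have "- F e \<in> S"
        unfolding S_def using e2 2 by auto
      then have "- F e \<le> Sup S"
        using \<open>bdd_above S\<close> by (rule cSup_upper)
      then have "0 \<le> p * (F e + Sup S)"
        using 2 by simp
      then show ?thesis
        using Fe 2 by (simp add: distrib_left)
    next
      case 3
      have "Sup S \<le> F e"
        using ne by (rule cSup_least) (rule ub, use e2 3 in auto)
      then have "p * F e \<le> p * Sup S"
        using 3 by (simp add: mult_left_mono_neg)
      then show ?thesis
        using Fe 3 by linarith
    qed
    then show "0 \<le> F c + 2 * c 0 * c ?L * Sup S"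
      by (simp add: p_def)
  qed
qed

text \<open>Deleting the last or the first index leaves the given Toeplitz matrix, by shift
  invariance. Only the two corner entries are new, so \<open>corner_completion\<close>
  applies.\<close>

lemma toeplitz_psd_extend_Suc:
  assumes psd: "toeplitz_psd (Suc m) s"
  shows "\<exists>z. toeplitz_psd (Suc (Suc m)) (s(Suc m := z))"
proof -
  define s0 where "s0 = s(Suc m := 0)"
  let ?F = "\<lambda>c. \<Sum>i<m+2. \<Sum>j<m+2. c i * c j * s0 (index_dist i j)"
  have s0: "s0 (index_dist i j) = s (index_dist i j)" if "i < Suc m" "j < Suc m" for i j
    using that by (auto simp: s0_def index_dist_def)
  have pos: "0 \<le> (\<Sum>i<Suc m. \<Sum>j<Suc m. c i * c j * s0 (index_dist i j))" for c
  proof -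
    have "(\<Sum>i<Suc m. \<Sum>j<Suc m. c i * c j * s0 (index_dist i j))
        = (\<Sum>i<Suc m. \<Sum>j<Suc m. c i * c j * s (index_dist i j))"
      by (intro sum.cong refl) (simp add: s0)
    then show ?thesis
      using psd_onD[OF psd, of c] by (simp del: sum.lessThan_Suc)
  qed
  have "\<exists>z. \<forall>c. 0 \<le> ?F c + 2 * c 0 * c (Suc m) * z"
  proof (rule corner_completion)
    fix c :: "nat \<Rightarrow> real" assume "c (Suc m) = 0"
    then show "0 \<le> ?F c"
      using pos[of c] by simp
  next
    fix c :: "nat \<Rightarrow> real" assume c: "c 0 = 0"
    have "?F c = (\<Sum>i<Suc m. \<Sum>j<Suc m. c (Suc i) * c (Suc j) * s0 (index_dist (Suc i) (Suc j)))"
      using c by (simp add: sum.lessThan_Suc_shift del: sum.lessThan_Suc)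
    then show "0 \<le> ?F c"
      using pos[of "\<lambda>i. c (Suc i)"] by (simp add: index_dist_def del: sum.lessThan_Suc)
  qed
  then obtain z where z: "0 \<le> ?F c + 2 * c 0 * c (Suc m) * z" for c
    by blast
  have "toeplitz_psd (Suc (Suc m)) (s(Suc m := z))"
    unfolding psd_on_def
  proof
    fix c :: "nat \<Rightarrow> real"
    let ?G = "\<lambda>i j. c i * c j * (s(Suc m := z)) (index_dist i j)"
    \<comment> \<open>\<open>?c\<close> restores the two corner entries, which are 0 in
      \<open>s0\<close>.\<close>
    let ?c = "\<lambda>i j. (if i = 0 \<and> j = Suc m then c 0 * c (Suc m) * z else 0)
        + (if i = Suc m \<and> j = 0 then c 0 * c (Suc m) * z else 0)"
    have "?G i j = c i * c j * s0 (index_dist i j) + ?c i j" if "i < m+2" "j < m+2" for i j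
      using that by (auto simp: s0_def index_dist_def)
    then have "(\<Sum>i<m+2. \<Sum>j<m+2. ?G i j) = ?F c + (\<Sum>i<m+2. \<Sum>j<m+2. ?c i j)"
      unfolding sum.distrib[symmetric] by (intro sum.cong) auto
    also have "(\<Sum>i<m+2. \<Sum>j<m+2. ?c i j) = 2 * c 0 * c (Suc m) * z"
    proof -
      have a: "(\<Sum>j<m+2. if i = 0 \<and> j = Suc m then v else 0) = (if i = 0 then v else 0)"
        for i :: nat and v :: real
        by (cases "i = 0") (auto simp: sum.delta)
      have b: "(\<Sum>j<m+2. if i = Suc m \<and> j = 0 then v else 0) = (if i = Suc m then v else 0)"
        for i :: nat and v :: real
        by (cases "i = Suc m") (auto simp: sum.delta)
      show ?thesis
        unfolding sum.distrib a b by (simp add: sum.delta del: sum.lessThan_Suc)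
    qed
    finally show "0 \<le> (\<Sum>i<Suc (Suc m). \<Sum>j<Suc (Suc m). ?G i j)"
      using z[of c] by (simp del: sum.lessThan_Suc)
  qed
  then show ?thesis ..
qed

lemma toeplitz_psd_extend:
  assumes "toeplitz_psd (Suc m) s"
  shows "\<exists>s'. toeplitz_psd n s' \<and> (\<forall>d\<le>m. s' d = s d)"
proof -
  have "\<exists>s'. toeplitz_psd (Suc (m + e)) s' \<and> (\<forall>d\<le>m. s' d = s d)" for e
  proof (induction e)
    case 0
    then show ?case
      using assms by auto
  next
    case (Suc e)
    then obtain s' where s': "toeplitz_psd (Suc (m + e)) s'" "\<forall>d\<le>m. s' d = s d"
      by blast
    obtain z where "toeplitz_psd (Suc (Suc (m + e))) (s'(Suc (m + e) := z))"
      using toeplitz_psd_extend_Suc[OF s'(1)] by blast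
    then show ?case
      using s'(2) by (intro exI[of _ "s'(Suc (m + e) := z)"]) auto
  qed
  \<comment> \<open>Length \<open>Suc (m + n)\<close> is at least \<open>n\<close> in all cases, so
    a principal submatrix of size \<open>n\<close> can be taken.\<close>
  from this[of n] obtain s' where s': "toeplitz_psd (Suc (m + n)) s'" "\<forall>d\<le>m. s' d = s d"
    by blast
  then show ?thesis
    using psd_on_subset[of "{..<Suc (m + n)}" _ "{..<n}"] by auto
qed

text \<open>Grouping indices by their residue modulo \<open>k\<close> makes the matrix block
  diagonal, and within a block the entries are those of \<open>s\<close> at the quotients. Hence the
  form is the sum over \<open>\<rho>\<close> of the forms at \<open>e \<rho>\<close>, the
  restriction of \<open>c\<close> to one residue class.\<close>

lemma toeplitz_psd_dilate:
  assumes psd: "toeplitz_psd n s" and k: "k \<ge> 1"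
  shows "toeplitz_psd n (\<lambda>d. if k dvd d then s (d div k) else 0)"
  unfolding psd_on_def
proof
  fix c :: "nat \<Rightarrow> real"
  let ?K = "\<lambda>i j. s (index_dist (i div k) (j div k))"
  define e where "e \<rho> i = (if i mod k = \<rho> then c i else 0)" for \<rho> i
  have "i div k < n" if "i < n" for i
    using that by (meson div_le_dividend le_less_trans)
  then have pos: "psd_on {..<n} ?K"
    using psd by (intro psd_on_pullback[where J = "{..<n}" and \<phi> = "\<lambda>i. i div k"]) auto
  have entry: "c i * c j * (if k dvd index_dist i j then s (index_dist i j div k) else 0)
      = (\<Sum>\<rho><k. e \<rho> i * e \<rho> j * ?K i j)" for i j
  proof (cases "i mod k = j mod k")
    case True
    have idist: "index_dist i j = k * index_dist (i div k) (j div k)"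
    proof -
      have "int i - int j = int k * (int (i div k) - int (j div k))"
        using True
        by (metis add_diff_cancel_right int_distrib(4) mult_div_mod_eq of_nat_add of_nat_mult)
      then show ?thesis
        by (simp add: index_dist_def abs_mult nat_mult_distrib)
    qed
    have "(\<Sum>\<rho><k. e \<rho> i * e \<rho> j * ?K i j)
        = (\<Sum>\<rho><k. if \<rho> = i mod k then c i * c j * ?K i j else 0)"
      using True by (intro sum.cong) (auto simp: e_def)
    also have "\<dots> = c i * c j * ?K i j"
      using k by (simp add: sum.delta)
    finally show ?thesis
      using idist k by simp
  next
    case False
    have "\<not> k dvd index_dist i j"
    proof
      assume "k dvd index_dist i j"
      then have "int k dvd int i - int j"
        by (simp add: index_dist_def)
      then have "int i mod int k = int j mod int k"
        by (simp add: mod_eq_dvd_iff)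
      then show False
        using False by (metis of_nat_eq_iff zmod_int)
    qed
    moreover have "(\<Sum>\<rho><k. e \<rho> i * e \<rho> j * ?K i j) = 0"
      using False by (intro sum.neutral) (simp add: e_def)
    ultimately show ?thesis
      by simp
  qed
  have "(\<Sum>i<n. \<Sum>j<n. c i * c j * (if k dvd index_dist i j then s (index_dist i j div k) else 0))
      = (\<Sum>\<rho><k. \<Sum>i<n. \<Sum>j<n. e \<rho> i * e \<rho> j * ?K i j)"
    unfolding entry by (subst sum.swap[of _ _ "{..<n}"]; subst sum.swap[of _ _ "{..<n}"]) simp
  also have "0 \<le> \<dots>"
    by (intro sum_nonneg psd_onD[OF pos])
  finally show "0 \<le> (\<Sum>i<n. \<Sum>j<n. c i * c j *
      (if k dvd index_dist i j then s (index_dist i j div k) else 0))" .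
qed

text \<open>Here \<open>s\<close> measures distances in units of \<open>k\<close>. It is first
  extended to length \<open>n\<close> and then dilated.\<close>

lemma toeplitz_completion_of_multiples:
  assumes k: "k \<ge> 1" and psd: "toeplitz_psd (Suc r) s"
    and agree: "\<And>d. d \<in> P \<union> {0} \<Longrightarrow> \<exists>j\<le>r. d = j * k \<and> s j = t d"
  shows "\<exists>A. completion n (partial_toeplitz P t) A \<and> psd_mat A \<and> toeplitz_mat A"
proof -
  obtain s' where s': "toeplitz_psd n s'" "\<forall>d\<le>r. s' d = s d"
    using toeplitz_psd_extend[OF psd] by blast
  show ?thesis
  proof (rule toeplitz_completionI[OF toeplitz_psd_dilate[OF s'(1) k]])
    fix d assume "d \<in> P \<union> {0}"
    then obtain j where "j \<le> r" "d = j * k" "s j = t d"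
      using agree by blast
    then show "(if k dvd d then s' (d div k) else 0) = t d"
      using s'(2) k by simp
  qed
qed


section \<open>Angles around the cycle with steps \<open>+k\<close> and \<open>-r\<close>\<close>

lemma nonneg_binary_form_discriminant:
  fixes P Q R :: real
  assumes form: "\<And>a b. 0 \<le> a\<^sup>2 * P + 2 * a * b * Q + b\<^sup>2 * R"
  shows "Q\<^sup>2 \<le> P * R"
proof (cases "R = 0")
  case True
  have "Q = 0"
  proof (rule ccontr)
    assume "Q \<noteq> 0"
    \<comment> \<open>With \<open>R = 0\<close> the form is linear in \<open>b\<close>, and this
      \<open>b\<close> gives it the value \<open>-1\<close>.\<close>
    then show False
      using form[of 1 "- (P + 1) / (2 * Q)"] True by (simp add: field_simps)
  qed
  with True show ?thesis
    by simp
next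
  case False
  then have R: "0 < R"
    using form[of 0 1] by simp
  have "0 \<le> R * (P * R - Q\<^sup>2)"
    using form[of R "- Q"] by (simp add: algebra_simps power2_eq_square)
  then show ?thesis
    using R by (simp add: zero_le_mult_iff)
qed

text \<open>The points may coincide, so this also yields the inequalities for one or two
  points.\<close>

lemma psd_on_three_points:
  assumes psd: "psd_on J K" and fin: "finite J" and mem: "i \<in> J" "j \<in> J" "l \<in> J"
  shows "0 \<le> a\<^sup>2 * K i i + b\<^sup>2 * K j j + c\<^sup>2 * K l l + a * b * (K i j + K j i)
      + a * c * (K i l + K l i) + b * c * (K j l + K l j)"
proof -
  define \<phi> where "\<phi> m = (if m = 0 then i else if m = 1 then j else l)" for m :: nat
  define v where "v m = (if m = 0 then a else if m = 1 then b else c)" for m :: nat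
  have "psd_on {..<3} (\<lambda>m m'. K (\<phi> m) (\<phi> m'))"
    by (rule psd_on_pullback[OF psd]) (use fin mem in \<open>auto simp: \<phi>_def\<close>)
  from psd_onD[OF this, of v] show ?thesis
    by (simp add: numeral_3_eq_3 \<phi>_def v_def algebra_simps power2_eq_square)
qed

context
  fixes K :: "'a \<Rightarrow> 'a \<Rightarrow> real" and J :: "'a set"
  assumes psd: "psd_on J K" and fin: "finite J"
    and diag: "\<And>i. i \<in> J \<Longrightarrow> K i i = 1"
    and sym: "\<And>i j. i \<in> J \<Longrightarrow> j \<in> J \<Longrightarrow> K j i = K i j"
begin

lemma correlation_abs_le_1:
  assumes "i \<in> J" "j \<in> J"
  shows "\<bar>K i j\<bar> \<le> 1"
proof -
  have "K i i = 1" "K j j = 1" "K j i = K i j"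
    using assms diag sym by auto
  then show ?thesis
    using psd_on_three_points[OF psd fin assms(1,2,2), of 1 1 0]
      psd_on_three_points[OF psd fin assms(1,2,2), of 1 "-1" 0]
    by simp
qed

text \<open>For unit vectors with Gram matrix \<open>K\<close>, this is the Cauchy-Schwarz
  inequality for the components of the vectors \<open>i\<close> and \<open>l\<close> orthogonal to
  the vector \<open>j\<close>. The coefficient chosen at \<open>j\<close> removes the parallel
  components.\<close>

lemma correlation_three_points:
  assumes mem: "i \<in> J" "j \<in> J" "l \<in> J"
  shows "(K i l - K i j * K j l)\<^sup>2 \<le> (1 - (K i j)\<^sup>2) * (1 - (K j l)\<^sup>2)"
proof (rule nonneg_binary_form_discriminant)
  fix a b :: real
  have "K j i = K i j" "K l i = K i l" "K l j = K j l"
    using mem sym by auto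
  then show "0 \<le> a\<^sup>2 * (1 - (K i j)\<^sup>2) + 2 * a * b * (K i l - K i j * K j l) + b\<^sup>2 * (1 - (K j l)\<^sup>2)"
    using psd_on_three_points[OF psd fin mem, of a "- (a * K i j + b * K j l)" b] mem
    by (simp add: diag algebra_simps power2_eq_square)
qed

end

text \<open>By \<open>det\<close>, \<open>z\<close> is at least the cosine of the sum of the two
  angles. Monotonicity of \<open>arccos\<close> applies when that sum is at most \<open>pi\<close>;
  otherwise the bound is trivial.\<close>

lemma arccos_triangle:
  assumes abs: "\<bar>u\<bar> \<le> 1" "\<bar>w\<bar> \<le> 1" "\<bar>z\<bar> \<le> 1"
    and det: "(z - u * w)\<^sup>2 \<le> (1 - u\<^sup>2) * (1 - w\<^sup>2)"
  shows "arccos z \<le> arccos u + arccos w"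
proof (cases "arccos u + arccos w \<le> pi")
  case True
  have "\<bar>z - u * w\<bar> \<le> sqrt (1 - u\<^sup>2) * sqrt (1 - w\<^sup>2)"
    using real_sqrt_le_mono[OF det] by (simp add: real_sqrt_mult)
  moreover have "cos (arccos u + arccos w) = u * w - sqrt (1 - u\<^sup>2) * sqrt (1 - w\<^sup>2)"
    using abs by (simp add: cos_add cos_arccos_abs sin_arccos_abs)
  ultimately have "cos (arccos u + arccos w) \<le> z"
    by linarith
  then have "arccos z \<le> arccos (cos (arccos u + arccos w))"
    using abs by (intro arccos_le_arccos) auto
  also have "\<dots> = arccos u + arccos w"
    using abs True by (intro arccos_cos add_nonneg_nonneg arccos_lbound) auto
  finally show ?thesis .
next
  case False
  have "arccos z \<le> pi"
    using abs by (intro arccos_ubound) auto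
  with False show ?thesis
    by linarith
qed

lemma closed_walk_step_counts:
  fixes k r p q i :: nat
  defines "d \<equiv> gcd k r"
  assumes pos: "k \<ge> 1" "r \<ge> 1" and pq: "p + q = k div d + r div d"
    and i: "i < k + r" "i + q * r = p * k"
  shows "i = 0" "p = r div d" "q = k div d"
proof -
  have d: "d \<ge> 1"
    using pos by (simp add: d_def Suc_le_eq)
  define k' r' where "k' = k div d" and "r' = r div d"
  have kr: "k = d * k'" "r = d * r'"
    by (simp_all add: d_def k'_def r'_def)
  have "k' \<ge> 1"
    using kr pos by (auto simp: Suc_le_eq intro!: Nat.gr0I)
  \<comment> \<open>Adding \<open>p * r\<close> to both sides makes the step total appear. With
    \<open>N = k + r\<close> the equation then reads \<open>i + N * r' = N * p\<close>, so
    \<open>N\<close> divides \<open>i < N\<close>.\<close>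
  have "i + (p + q) * r = p * (k + r)"
    using i(2) by (simp add: algebra_simps)
  moreover have "p + q = k' + r'"
    using pq by (simp add: k'_def r'_def)
  moreover define N where "N = d * (k' + r')"
  ultimately have eq: "i + N * r' = N * p"
    using kr by (simp add: algebra_simps)
  then have "N dvd i"
    by (metis dvd_add_left_iff dvd_triv_left)
  moreover have "i < N"
    using i(1) kr by (simp add: N_def algebra_simps)
  ultimately show i0: "i = 0"
    using nat_dvd_not_less by blast
  have "N \<ge> 1"
    using d \<open>k' \<ge> 1\<close> by (simp add: N_def)
  then have "p = r'"
    using eq i0 \<open>N \<ge> 1\<close> by simp
  moreover from this have "q = k'"
    using pq by (simp add: k'_def r'_def)
  ultimately show "p = r div d" "q = k div d"
    by (simp_all add: k'_def r'_def)
qed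

text \<open>Each step of the walk adds at most the angle of its edge. After \<open>k' + r'\<close>
  steps it is back at 0 with accumulated sign \<open>-1\<close>, so the angle reached is
  \<open>arccos (-1) = pi\<close>.\<close>

lemma cycle_angle_bound:
  fixes K :: "nat \<Rightarrow> nat \<Rightarrow> real" and k r n :: nat and x y \<sigma> \<tau> :: real
  defines "d \<equiv> gcd k r"
  assumes psd: "psd_on {..<n} K"
    and diag: "\<And>i. i < n \<Longrightarrow> K i i = 1"
    and sym: "\<And>i j. i < n \<Longrightarrow> j < n \<Longrightarrow> K j i = K i j"
    and Kx: "\<And>i. i + k < n \<Longrightarrow> K i (i + k) = x"
    and Ky: "\<And>i. i + r < n \<Longrightarrow> K i (i + r) = y"
    and n: "k + r \<le> n" and pos: "k \<ge> 1" "r \<ge> 1"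
    and sgn: "\<bar>\<sigma>\<bar> = 1" "\<bar>\<tau>\<bar> = 1" and odd: "\<sigma> ^ (r div d) * \<tau> ^ (k div d) = - 1"
  shows "pi \<le> real (r div d) * arccos (\<sigma> * x) + real (k div d) * arccos (\<tau> * y)"
proof -
  have bd: "\<bar>K i j\<bar> \<le> 1" if "i < n" "j < n" for i j
    using correlation_abs_le_1[OF psd] diag sym that by simp
  \<comment> \<open>Signs enter by multiplying the unit vectors at \<open>i\<close> and
    \<open>j\<close> by \<open>\<epsilon>\<close> and \<open>\<epsilon> * \<delta>\<close>.\<close>
  have tri: "arccos (\<epsilon> * \<delta> * K 0 j) \<le> arccos (\<epsilon> * K 0 i) + arccos (\<delta> * K i j)"
    if "i < n" "j < n" and e: "\<bar>\<epsilon>\<bar> = 1" "\<bar>\<delta>\<bar> = 1" for i j \<epsilon> \<delta>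
  proof (rule arccos_triangle)
    have e2: "\<epsilon>\<^sup>2 = 1" "\<delta>\<^sup>2 = 1"
      using e by (metis power2_abs power_one)+
    have "(K 0 j - K 0 i * K i j)\<^sup>2 \<le> (1 - (K 0 i)\<^sup>2) * (1 - (K i j)\<^sup>2)"
      using correlation_three_points[OF psd] diag sym that by simp
    moreover have "\<epsilon> * \<delta> * K 0 j - \<epsilon> * K 0 i * (\<delta> * K i j) = \<epsilon> * \<delta> * (K 0 j - K 0 i * K i j)"
      by (simp add: algebra_simps)
    ultimately show "(\<epsilon> * \<delta> * K 0 j - \<epsilon> * K 0 i * (\<delta> * K i j))\<^sup>2
        \<le> (1 - (\<epsilon> * K 0 i)\<^sup>2) * (1 - (\<delta> * K i j)\<^sup>2)"
      by (simp add: power_mult_distrib e2)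
  qed (use bd that in \<open>auto simp: abs_mult\<close>)
  \<comment> \<open>After \<open>p\<close> steps up and \<open>q\<close> steps down the position is
    \<open>i = p * k - q * r\<close>, written without subtraction.\<close>
  have walk: "\<exists>p q i. p + q = s \<and> i < k + r \<and> i + q * r = p * k
      \<and> arccos (\<sigma> ^ p * \<tau> ^ q * K 0 i) \<le> real p * arccos (\<sigma> * x) + real q * arccos (\<tau> * y)" for s
  proof (induction s)
    case 0
    show ?case
      by (rule exI[of _ 0], rule exI[of _ 0], rule exI[of _ 0]) (use pos n diag in auto)
  next
    case (Suc s)
    then obtain p q i where pq: "p + q = s" and i: "i < k + r" "i + q * r = p * k"
      and le: "arccos (\<sigma> ^ p * \<tau> ^ q * K 0 i) \<le> real p * arccos (\<sigma> * x) + real q * arccos (\<tau> * y)"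
      by blast
    have e: "\<bar>\<sigma> ^ p * \<tau> ^ q\<bar> = 1"
      using sgn by (simp add: abs_mult power_abs)
    show ?case
    proof (cases "i < r")
      case True
      have "arccos (\<sigma> ^ Suc p * \<tau> ^ q * K 0 (i + k))
          \<le> real (Suc p) * arccos (\<sigma> * x) + real q * arccos (\<tau> * y)"
        using tri[of i "i + k" "\<sigma> ^ p * \<tau> ^ q" \<sigma>] True n e sgn le Kx[of i]
        by (simp add: mult_ac distrib_right)
      then show ?thesis
        using True pq i by (intro exI[of _ "Suc p"] exI[of _ q] exI[of _ "i + k"]) auto
    next
      case False
      have "K i (i - r) = y"
        using Ky[of "i - r"] sym[of "i - r" i] False i n by simp
      then have "arccos (\<sigma> ^ p * \<tau> ^ Suc q * K 0 (i - r))
          \<le> real p * arccos (\<sigma> * x) + real (Suc q) * arccos (\<tau> * y)"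
        using tri[of i "i - r" "\<sigma> ^ p * \<tau> ^ q" \<tau>] False i n e sgn le less_imp_diff_less[of i n r]
        by (simp add: mult_ac distrib_right)
      then show ?thesis
        using False pq i by (intro exI[of _ p] exI[of _ "Suc q"] exI[of _ "i - r"]) auto
    qed
  qed
  from walk[of "k div d + r div d"] obtain p q i
    where pq: "p + q = k div d + r div d" and i: "i < k + r" "i + q * r = p * k"
      and le: "arccos (\<sigma> ^ p * \<tau> ^ q * K 0 i) \<le> real p * arccos (\<sigma> * x) + real q * arccos (\<tau> * y)"
    by blast
  have "i = 0" "p = r div d" "q = k div d"
    using closed_walk_step_counts[OF pos pq[unfolded d_def] i] by (simp_all add: d_def)
  then show ?thesis
    using le odd diag[of 0] n pos by simp
qed

section \<open>The convex hull of the curve \<open>(cos k\<theta>, cos r\<theta>)\<close>\<close>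

definition attainable :: "nat \<Rightarrow> nat \<Rightarrow> nat \<Rightarrow> real \<Rightarrow> real \<Rightarrow> bool" where
  "attainable n k r x y \<longleftrightarrow> (\<exists>s. toeplitz_psd n s \<and> s 0 = 1 \<and> s k = x \<and> s r = y)"

text \<open>This is the Gram matrix of the points
  \<open>(cos (i * \<theta>), sin (i * \<theta>))\<close>, so the form is a sum of two
  squares.\<close>

lemma toeplitz_psd_cos: "toeplitz_psd n (\<lambda>d. cos (real d * \<theta>))"
  unfolding psd_on_def
proof
  fix c :: "nat \<Rightarrow> real"
  have "cos (real (index_dist i j) * \<theta>)
      = cos (real i * \<theta>) * cos (real j * \<theta>) + sin (real i * \<theta>) * sin (real j * \<theta>)" for i j
  proof -
    have "real (index_dist i j) = \<bar>real i - real j\<bar>"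
      by (simp add: index_dist_def)
    then have "cos (real (index_dist i j) * \<theta>) = cos ((real i - real j) * \<theta>)"
      by (metis abs_if cos_minus minus_mult_left)
    then show ?thesis
      by (simp add: left_diff_distrib cos_diff)
  qed
  then have "(\<Sum>i<n. \<Sum>j<n. c i * c j * cos (real (index_dist i j) * \<theta>))
      = (\<Sum>i<n. \<Sum>j<n. (c i * cos (real i * \<theta>)) * (c j * cos (real j * \<theta>)))
        + (\<Sum>i<n. \<Sum>j<n. (c i * sin (real i * \<theta>)) * (c j * sin (real j * \<theta>)))"
    unfolding sum.distrib[symmetric] by (intro sum.cong refl) (simp add: algebra_simps)
  also have "\<dots> = (\<Sum>i<n. c i * cos (real i * \<theta>))\<^sup>2 + (\<Sum>i<n. c i * sin (real i * \<theta>))\<^sup>2"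
    by (simp add: power2_eq_square sum_product)
  finally show "0 \<le> (\<Sum>i<n. \<Sum>j<n. c i * c j * cos (real (index_dist i j) * \<theta>))"
    by simp
qed

lemma attainable_convex:
  assumes "attainable n k r x y" "attainable n k r x' y'" "0 \<le> u" "u \<le> 1"
  shows "attainable n k r ((1 - u) * x + u * x') ((1 - u) * y + u * y')"
proof -
  obtain s s' where s: "toeplitz_psd n s" "s 0 = 1" "s k = x" "s r = y"
    and s': "toeplitz_psd n s'" "s' 0 = 1" "s' k = x'" "s' r = y'"
    using assms(1,2) by (auto simp: attainable_def)
  have "toeplitz_psd n (\<lambda>d. (1 - u) * s d + u * s' d)"
    using assms(3,4) by (intro psd_on_add psd_on_scale s(1) s'(1)) auto
  then show ?thesis
    unfolding attainable_def
    by (intro exI[of _ "\<lambda>d. (1 - u) * s d + u * s' d"]) (simp add: s s')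
qed

lemma between_as_convex_combination:
  fixes a b x :: real
  assumes "a \<le> x" "x \<le> b"
  obtains u where "0 \<le> u" "u \<le> 1" "(1 - u) * a + u * b = x"
proof (cases "a = b")
  case True
  then show ?thesis
    using assms that[of 0] by simp
next
  case False
  have "(1 - (x - a) / (b - a)) * a + (x - a) / (b - a) * b = a + (x - a) / (b - a) * (b - a)"
    by (simp only: left_diff_distrib right_diff_distrib mult_1)
  then have "(1 - (x - a) / (b - a)) * a + (x - a) / (b - a) * b = x"
    using False by simp
  then show ?thesis
    using assms False by (intro that[of "(x - a) / (b - a)"]) (auto simp: field_simps)
qed

lemma attainable_between:
  shows "attainable n k r a y \<Longrightarrow> attainable n k r b y \<Longrightarrow> a \<le> x \<Longrightarrow> x \<le> b \<Longrightarrow> attainable n k r x y"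
    and "attainable n k r x a \<Longrightarrow> attainable n k r x b \<Longrightarrow> a \<le> y \<Longrightarrow> y \<le> b \<Longrightarrow> attainable n k r x y"
proof -
  assume A: "attainable n k r a y" "attainable n k r b y" and ab: "a \<le> x" "x \<le> b"
  obtain u where "0 \<le> u" "u \<le> 1" "(1 - u) * a + u * b = x"
    using between_as_convex_combination[OF ab] .
  then show "attainable n k r x y"
    using attainable_convex[OF A, of u] by (simp add: algebra_simps)
next
  assume A: "attainable n k r x a" "attainable n k r x b" and ab: "a \<le> y" "y \<le> b"
  obtain u where "0 \<le> u" "u \<le> 1" "(1 - u) * a + u * b = y"
    using between_as_convex_combination[OF ab] .
  then show "attainable n k r x y"
    using attainable_convex[OF A, of u] by (simp add: algebra_simps)
qed

text \<open>The condition says that \<open>(A, B) = (k * \<theta>, r * \<theta>)\<close> for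
  \<open>\<theta> = A / k\<close>.\<close>

lemma attainable_cos:
  assumes "k \<ge> 1" "real k * B = real r * A"
  shows "attainable n k r (cos A) (cos B)"
proof -
  have "real r * (A / real k) = B" "real k * (A / real k) = A"
    using assms by (auto simp: field_simps)
  then show ?thesis
    unfolding attainable_def
    by (intro exI[of _ "\<lambda>d. cos (real d * (A / real k))"] conjI toeplitz_psd_cos) simp_all
qed

lemma cos_add_int_pi: "cos (a + of_int m * pi) = (if even m then 1 else - 1) * cos a"
  using cos_npi_int[of m] sin_npi_int[of m] by (simp add: cos_add mult.commute)

text \<open>The equation modulo 2 leaves two parity patterns for \<open>(l, m)\<close>, the same two
  that \<open>par\<close> allows. Adding \<open>(r, k)\<close> to a solution swaps them, since
  \<open>k\<close> and \<open>r\<close> are not both even.\<close>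

lemma bezout_with_parity:
  fixes k r :: nat and p q :: bool
  assumes cop: "coprime k r" and par: "odd (r * of_bool p + k * of_bool q)"
  obtains l m :: int where "int k * l - int r * m = 1" "odd m \<longleftrightarrow> p" "odd l \<longleftrightarrow> q"
proof -
  obtain u v where uv: "u * int k + v * int r = 1"
    using cop by (metis bezout_int coprime_iff_gcd_eq_1 gcd_int_int_eq of_nat_1)
  define l0 m0 where "l0 = u" and "m0 = - v"
  have 0: "int k * l0 - int r * m0 = 1" "int k * (l0 + int r) - int r * (m0 + int k) = 1"
    using uv by (simp_all add: l0_def m0_def algebra_simps)
  have "odd (int k * l0 - int r * m0)"
    using 0 by simp
  then have "(odd m0 \<longleftrightarrow> p) \<and> (odd l0 \<longleftrightarrow> q)
      \<or> (odd (m0 + int k) \<longleftrightarrow> p) \<and> (odd (l0 + int r) \<longleftrightarrow> q)"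
    using par by (cases p; cases q) auto
  then show ?thesis
    using 0 that by blast
qed

context
  fixes k r k' r' d :: nat
  assumes k: "k = d * k'" and r: "r = d * r'" and cop: "coprime k' r'"
    and pos: "k \<ge> 1" "r \<ge> 1"
begin

text \<open>Exactly two corners of the square satisfy \<open>even\<close>. The curve passes through
  them at \<open>\<theta> = 0\<close> and \<open>\<theta> = pi / d\<close>.\<close>

lemma attainable_corner:
  fixes \<sigma> \<tau> :: real
  assumes sgn: "\<sigma> = 1 \<or> \<sigma> = - 1" "\<tau> = 1 \<or> \<tau> = - 1" and even: "\<sigma> ^ r' * \<tau> ^ k' = 1"
  shows "attainable n k r \<sigma> \<tau>"
proof -
  have not_both: "odd k' \<or> odd r'"
    using cop by (metis coprime_common_divisor odd_one)
  have "\<sigma> = 1 \<and> \<tau> = 1 \<or> \<sigma> = (- 1) ^ k' \<and> \<tau> = (- 1) ^ r'"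
    using sgn even not_both by (cases "even k'"; cases "even r'") auto
  then show ?thesis
  proof
    assume "\<sigma> = 1 \<and> \<tau> = 1"
    then show ?thesis
      using attainable_cos[of k 0 r 0] pos by simp
  next
    assume "\<sigma> = (- 1) ^ k' \<and> \<tau> = (- 1) ^ r'"
    moreover have "attainable n k r (cos (real k' * pi)) (cos (real r' * pi))"
      by (rule attainable_cos) (use pos k r in auto)
    ultimately show ?thesis
      by simp
  qed
qed

text \<open>The signs are absorbed into the angles \<open>a + m * pi\<close> and
  \<open>- b + l * pi\<close>, with the parities of \<open>m\<close> and \<open>l\<close> given by
  \<open>\<sigma>\<close> and \<open>\<tau>\<close>. By \<open>ab\<close>, these angles belong to a
  common \<open>\<theta>\<close> once \<open>k' * l - r' * m = 1\<close>.\<close>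

lemma attainable_arc:
  fixes \<sigma> \<tau> :: real
  assumes sgn: "\<sigma> = 1 \<or> \<sigma> = - 1" "\<tau> = 1 \<or> \<tau> = - 1" and odd: "\<sigma> ^ r' * \<tau> ^ k' = - 1"
    and ab: "real r' * a + real k' * b = pi"
  shows "attainable n k r (\<sigma> * cos a) (\<tau> * cos b)"
proof -
  have "odd (r' * of_bool (\<sigma> = - 1) + k' * of_bool (\<tau> = - 1))"
    using sgn odd by (cases "even k'"; cases "even r'") auto
  then obtain l m :: int where lm: "int k' * l - int r' * m = 1"
    and par: "odd m \<longleftrightarrow> \<sigma> = - 1" "odd l \<longleftrightarrow> \<tau> = - 1"
    using bezout_with_parity[OF cop] by metis
  have "real k' * (of_int l * pi) - real r' * (of_int m * pi) = pi"
  proof -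
    have "real k' * of_int l - real r' * of_int m = 1"
      using arg_cong[OF lm, of real_of_int] by simp
    then have "(real k' * of_int l - real r' * of_int m) * pi = pi"
      by simp
    then show ?thesis
      by (simp add: algebra_simps)
  qed
  then have "real k' * (- b + of_int l * pi) = real r' * (a + of_int m * pi)"
    using ab by (simp add: algebra_simps)
  then have "real k * (- b + of_int l * pi) = real r * (a + of_int m * pi)"
    by (simp add: k r mult.assoc)
  then have "attainable n k r (cos (a + of_int m * pi)) (cos (- b + of_int l * pi))"
    by (rule attainable_cos[OF pos(1)])
  moreover have "(if even m then 1 else - 1) = \<sigma>" "(if even l then 1 else - 1) = \<tau>"
    using par sgn by auto
  ultimately show ?thesis
    using cos_add_int_pi[of a m] cos_add_int_pi[of "- b" l] by (simp only: cos_minus)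
qed

text \<open>On the horizontal line through \<open>(x, y)\<close> there is an attainable point on each side: on an arc
  if the line meets the corresponding cut corner, and on a side of the square otherwise.\<close>

lemma attainable_if_angle_bounds:
  fixes x y :: real
  assumes bd: "\<bar>x\<bar> \<le> 1" "\<bar>y\<bar> \<le> 1"
    and angle: "\<And>\<sigma> \<tau>. \<bar>\<sigma>\<bar> = 1 \<Longrightarrow> \<bar>\<tau>\<bar> = 1 \<Longrightarrow> \<sigma> ^ r' * \<tau> ^ k' = - 1 \<Longrightarrow>
      pi \<le> real r' * arccos (\<sigma> * x) + real k' * arccos (\<tau> * y)"
  shows "attainable n k r x y"
proof -
  have pos': "k' \<ge> 1" "r' \<ge> 1"
    using pos k r by (auto simp: Suc_le_eq intro!: Nat.gr0I)
  have arcc: "0 \<le> arccos z \<and> arccos z \<le> pi \<and> cos (arccos z) = z" if "\<bar>z\<bar> \<le> 1" for z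
    using arccos[of z] that by auto
  have cut_or_not: "\<sigma> ^ r' * \<tau> ^ k' = 1 \<or> \<sigma> ^ r' * \<tau> ^ k' = - 1"
    if "\<sigma> = 1 \<or> \<sigma> = - 1" "\<tau> = 1 \<or> \<tau> = - 1" for \<sigma> \<tau> :: real
    using that by (cases "even k'"; cases "even r'") auto
  \<comment> \<open>The sign \<open>\<sigma>\<close> selects the direction: \<open>1\<close> is to
    the right, \<open>-1\<close> to the left.\<close>
  have side: "\<exists>x'. attainable n k r x' y \<and> \<sigma> * x \<le> \<sigma> * x'" if \<sigma>: "\<sigma> = 1 \<or> \<sigma> = - 1" for \<sigma>
  proof (cases "\<exists>\<tau>. (\<tau> = 1 \<or> \<tau> = - 1) \<and> \<sigma> ^ r' * \<tau> ^ k' = - 1 \<and> real k' * arccos (\<tau> * y) \<le> pi")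
    case True
    then obtain \<tau> where \<tau>: "\<tau> = 1 \<or> \<tau> = - 1" and odd: "\<sigma> ^ r' * \<tau> ^ k' = - 1"
      and small: "real k' * arccos (\<tau> * y) \<le> pi"
      by blast
    \<comment> \<open>The angle at which the horizontal line through \<open>y\<close> meets the arc
      near the corner \<open>(\<sigma>, \<tau>)\<close>.\<close>
    define a where "a = (pi - real k' * arccos (\<tau> * y)) / real r'"
    have ra: "real r' * a = pi - real k' * arccos (\<tau> * y)"
      using pos' by (simp add: a_def)
    have "attainable n k r (\<sigma> * cos a) (\<tau> * cos (arccos (\<tau> * y)))"
      using attainable_arc[OF \<sigma> \<tau> odd] ra by simp
    moreover have "\<tau> * cos (arccos (\<tau> * y)) = y"
      using arcc[of "\<tau> * y"] \<tau> bd by auto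
    moreover have "\<sigma> * x \<le> \<sigma> * (\<sigma> * cos a)"
    proof -
      have "real r' * a \<le> real r' * arccos (\<sigma> * x)"
        using angle[of \<sigma> \<tau>] \<sigma> \<tau> odd ra by auto
      then have "a \<le> arccos (\<sigma> * x)"
        using pos' by simp
      moreover have "0 \<le> a"
        using small by (simp add: a_def)
      moreover have "\<bar>\<sigma> * x\<bar> \<le> 1"
        using \<sigma> bd by auto
      ultimately have "\<sigma> * x \<le> cos a"
        using arcc[of "\<sigma> * x"] cos_monotone_0_pi_le[of a "arccos (\<sigma> * x)"] by simp
      then show ?thesis
        using \<sigma> by auto
    qed
    ultimately show ?thesis
      by auto
  next
    case False
    \<comment> \<open>Towards the end \<open>\<tau>\<close> of the vertical side at
      \<open>\<sigma>\<close>, the attainable point is the corner itself or, if that corner is cut,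
      the endpoint of the arc at \<open>a = 0\<close>, \<open>b = pi / k'\<close>.\<close>
    have side_end: "\<exists>y'. attainable n k r \<sigma> y' \<and> \<tau> * y \<le> \<tau> * y'" if \<tau>: "\<tau> = 1 \<or> \<tau> = - 1" for \<tau>
    proof (cases "\<sigma> ^ r' * \<tau> ^ k' = - 1")
      case True
      have "attainable n k r (\<sigma> * cos 0) (\<tau> * cos (pi / real k'))"
        by (rule attainable_arc[OF \<sigma> \<tau> True]) (use pos' in simp)
      moreover have "\<tau> * y \<le> cos (pi / real k')"
      proof -
        have "\<not> real k' * arccos (\<tau> * y) \<le> pi"
          using False True \<tau> by blast
        then have "pi / real k' \<le> arccos (\<tau> * y)"
          using pos' by (simp add: field_simps)
        moreover have "\<bar>\<tau> * y\<bar> \<le> 1"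
          using \<tau> bd by auto
        ultimately show ?thesis
          using arcc[of "\<tau> * y"] cos_monotone_0_pi_le[of "pi / real k'" "arccos (\<tau> * y)"] by simp
      qed
      ultimately show ?thesis
        using \<tau> by (intro exI[of _ "\<tau> * cos (pi / real k')"]) auto
    next
      case False
      then have "attainable n k r \<sigma> \<tau>"
        using attainable_corner[OF \<sigma> \<tau>] cut_or_not[OF \<sigma> \<tau>] by blast
      then show ?thesis
        using \<tau> bd by (intro exI[of _ \<tau>]) auto
    qed
    have "attainable n k r \<sigma> y"
      using side_end[of 1] side_end[of "- 1"] attainable_between(2)[of n k r \<sigma> _ _ y] by auto
    then show ?thesis
      using \<sigma> bd by (intro exI[of _ \<sigma>]) auto
  qed
  show ?thesis
    using side[of 1] side[of "- 1"] attainable_between(1)[of n k r _ y _ x] by auto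
qed

end

section \<open>The three patterns\<close>

lemma psd_on_zero_diagonal:
  assumes psd: "psd_on J K" and fin: "finite J" and mem: "i \<in> J" "j \<in> J"
    and diag: "K i i = 0" "K j j = 0" and sym: "K j i = K i j"
  shows "K i j = 0"
proof -
  have "0 \<le> 2 * c * K i j" for c
    using psd_on_three_points[OF psd fin mem mem(2), of 1 c 0] diag sym by simp
  from this[of 1] this[of "- 1"] show ?thesis
    by simp
qed

lemma two_diagonal_completion:
  fixes K :: "nat \<Rightarrow> nat \<Rightarrow> real"
  assumes psd: "psd_on {..<n} K" and sym: "\<And>i j. i < n \<Longrightarrow> j < n \<Longrightarrow> K j i = K i j"
    and spec: "\<And>i j. i < n \<Longrightarrow> j < n \<Longrightarrow> index_dist i j \<in> {0, k, r} \<Longrightarrow> K i j = t (index_dist i j)"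
    and n: "k + r \<le> n" and pos: "k \<ge> 1" "r \<ge> 1"
  shows "\<exists>s. toeplitz_psd n s \<and> (\<forall>d\<in>{0, k, r}. s d = t d)"
proof -
  have diag: "K i i = t 0" if "i < n" for i
    using spec[of i i] that by simp
  have Kk: "K i (i + k) = t k" if "i + k < n" for i
    using spec[of i "i + k"] that by (simp add: index_dist_def)
  have Kr: "K i (i + r) = t r" if "i + r < n" for i
    using spec[of i "i + r"] that by (simp add: index_dist_def)
  have "0 \<le> t 0"
    using psd_on_three_points[OF psd, of 0 0 0 1 0 0] diag[of 0] n pos by simp
  then consider "t 0 = 0" | "t 0 > 0"
    by linarith
  then show ?thesis
  proof cases
    case 1
    \<comment> \<open>A zero diagonal cannot be normalised, but it forces all specified values to
      vanish.\<close>
    have "K 0 j = 0" if "j < n" for j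
      using psd_on_zero_diagonal[OF psd, of 0 j] diag sym that 1 by simp
    then have "t k = 0" "t r = 0"
      using Kk[of 0] Kr[of 0] n pos by auto
    then show ?thesis
      using 1 by (intro exI[of _ "\<lambda>_. 0"]) (simp add: psd_on_def)
  next
    case 2
    define C where "C i j = inverse (t 0) * K i j" for i j
    have C: "psd_on {..<n} C"
      unfolding C_def using 2 by (intro psd_on_scale psd) simp
    have C_diag: "C i i = 1" if "i < n" for i
      using diag that 2 by (simp add: C_def)
    have C_sym: "C j i = C i j" if "i < n" "j < n" for i j
      using sym that by (simp add: C_def)
    define x y where "x = t k / t 0" and "y = t r / t 0"
    have Cx: "C i (i + k) = x" if "i + k < n" for i
      using Kk[OF that] by (simp add: C_def x_def divide_inverse)
    have Cy: "C i (i + r) = y" if "i + r < n" for i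
      using Kr[OF that] by (simp add: C_def y_def divide_inverse)
    have "\<bar>C 0 k\<bar> \<le> 1" "\<bar>C 0 r\<bar> \<le> 1"
      using correlation_abs_le_1[OF C] C_diag C_sym n pos by simp_all
    then have bd: "\<bar>x\<bar> \<le> 1" "\<bar>y\<bar> \<le> 1"
      using Cx[of 0] Cy[of 0] n pos by simp_all
    have "attainable n k r x y"
    proof (rule attainable_if_angle_bounds[OF _ _ _ pos bd])
      show "k = gcd k r * (k div gcd k r)" "r = gcd k r * (r div gcd k r)"
        by simp_all
      show "coprime (k div gcd k r) (r div gcd k r)"
        using pos by (intro div_gcd_coprime) auto
    qed (rule cycle_angle_bound[OF C C_diag C_sym Cx Cy n pos])
    then obtain s where s: "toeplitz_psd n s" "s 0 = 1" "s k = x" "s r = y"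
      by (auto simp: attainable_def)
    have "toeplitz_psd n (\<lambda>d. t 0 * s d)"
      using 2 by (intro psd_on_scale s(1)) simp
    then show ?thesis
      using s 2 by (intro exI[of _ "\<lambda>d. t 0 * s d"]) (simp add: x_def y_def)
  qed
qed

text \<open>The hypothesis on \<open>P\<close> holds for both patterns of multiples: up to
  \<open>r\<close>, only the multiplier \<open>r - 1\<close> may be missing. That distance occurs,
  up to symmetry, at the pairs \<open>(0, r - 1)\<close> and \<open>(1, r)\<close>, which the flip
  exchanges.\<close>

lemma multiples_completion:
  fixes K :: "nat \<Rightarrow> nat \<Rightarrow> real"
  assumes psd: "psd_on {..<n} K" and sym: "\<And>i j. i < n \<Longrightarrow> j < n \<Longrightarrow> K j i = K i j"
    and r: "r * k < n" "r \<ge> 1"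
    and spec: "\<And>i j. i < n \<Longrightarrow> j < n \<Longrightarrow> index_dist i j \<in> P \<union> {0} \<Longrightarrow> K i j = t (index_dist i j)"
    and P: "\<And>j. 1 \<le> j \<Longrightarrow> j + 2 \<le> r \<or> j = r \<Longrightarrow> j * k \<in> P"
  shows "\<exists>s. toeplitz_psd (Suc r) s \<and> (\<forall>j\<le>r. j * k \<in> P \<union> {0} \<longrightarrow> s j = t (j * k))"
proof -
  have lt: "i * k < n" if "i \<le> r" for i
    using r that by (meson le_less_trans mult_le_mono1)
  have dist: "index_dist (i * k) (j * k) = index_dist i j * k" for i j
  proof -
    have "int (i * k) - int (j * k) = (int i - int j) * int k"
      by (simp add: algebra_simps)
    then show ?thesis
      by (simp add: index_dist_def abs_mult nat_mult_distrib)
  qed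
  define L where "L i j = K (i * k) (j * k)" for i j
  define M where "M i j = 1 / 2 * (L i j + L (r - i) (r - j))" for i j
  have Lspec: "L i j = t (index_dist i j * k)"
    if "i \<le> r" "j \<le> r" "index_dist i j * k \<in> P \<union> {0}" for i j
    unfolding L_def using spec[OF lt lt, of i j] that by (simp add: dist)
  have L: "psd_on {..<Suc r} L"
    unfolding L_def
    by (rule psd_on_pullback[OF psd, where \<phi> = "\<lambda>i. i * k"]) (auto simp: less_Suc_eq_le intro: lt)
  have "psd_on {..<Suc r} (\<lambda>i j. L (r - i) (r - j))"
    by (rule psd_on_pullback[OF L, where \<phi> = "\<lambda>i. r - i"]) auto
  then have M: "psd_on {..<Suc r} M"
    unfolding M_def using L by (intro psd_on_scale psd_on_add) auto
  have flip: "index_dist (r - i) (r - j) = index_dist i j" if "i \<le> r" "j \<le> r" for i j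
    using that by (simp add: index_dist_def of_nat_diff)
  have Mspec: "M i j = t (index_dist i j * k)"
    if "i \<le> r" "j \<le> r" "index_dist i j * k \<in> P \<union> {0}" for i j
    using Lspec[of i j] Lspec[of "r - i" "r - j"] that flip[of i j] by (simp add: M_def)
  have Lsym: "L j i = L i j" if "i \<le> r" "j \<le> r" for i j
    unfolding L_def using sym lt that by simp
  have gap: "M i (i + (r - 1)) = M 0 (r - 1)" if "i + (r - 1) \<le> r" for i
  proof (cases "i = 0")
    case False
    then have "i = 1"
      using that r by simp
    moreover have "L 1 r = L r 1" "L (r - 1) 0 = L 0 (r - 1)"
      using r Lsym[of r 1] Lsym[of 0 "r - 1"] by simp_all
    ultimately show ?thesis
      using r by (simp add: M_def)
  qed simp
  \<comment> \<open>Constancy along a diagonal comes from the data at specified distances and from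
    \<open>gap\<close> at the remaining one.\<close>
  have up: "M i (i + e) = M 0 e" if "i + e \<le> r" for i e
  proof (cases "e * k \<in> P \<union> {0}")
    case True
    then show ?thesis
      using Mspec[of i "i + e"] Mspec[of 0 e] that by (simp add: index_dist_def)
  next
    case False
    then have "e \<noteq> 0" "\<not> (e + 2 \<le> r \<or> e = r)"
      using P[of e] by (auto simp: Suc_le_eq)
    then have "e = r - 1"
      using that by linarith
    then show ?thesis
      using gap that by simp
  qed
  have le: "M i j = M 0 (index_dist i j)" if "i \<le> j" "j \<le> r" for i j
  proof -
    have "index_dist i j = j - i"
      using that(1) by (simp add: index_dist_def)
    then show ?thesis
      using up[of i "j - i"] that by simp
  qed
  have "M i j = M 0 (index_dist i j)" if "i \<le> r" "j \<le> r" for i j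
  proof (cases "i \<le> j")
    case True
    then show ?thesis
      using le that by blast
  next
    case False
    have "M i j = M j i"
      using Lsym[of j i] Lsym[of "r - j" "r - i"] that by (simp add: M_def)
    then show ?thesis
      using False le[of j i] that by (simp add: index_dist_sym)
  qed
  then have "toeplitz_psd (Suc r) (M 0)"
    using M by (subst psd_on_cong[where L = M]) auto
  moreover have "M 0 j = t (j * k)" if "j \<le> r" "j * k \<in> P \<union> {0}" for j
    using Mspec[of 0 j] that by (simp add: index_dist_def)
  ultimately show ?thesis
    by blast
qed

theorem theorem3p4:
  fixes n :: nat and P :: "nat set" and t :: "nat \<Rightarrow> real"
  assumes "n \<ge> 2"
    and "P \<subseteq> {1..n - 1}"
    and "\<exists>r k :: nat. r \<ge> 1 \<and> k \<ge> 1 \<and>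
           (P = {j * k | j. 1 \<le> j \<and> j \<le> r}
          \<or> P = {j * k | j. 1 \<le> j \<and> j + 2 \<le> r} \<union> {r * k}
          \<or> (P = {k, r} \<and> n \<ge> k + r))"
    and "\<exists>A. completion n (partial_toeplitz P t) A \<and> psd_mat A"
  shows "\<exists>A. completion n (partial_toeplitz P t) A \<and> psd_mat A \<and> toeplitz_mat A"
proof -
  obtain r k where pos: "r \<ge> 1" "k \<ge> 1"
    and cases: "P = {j * k | j. 1 \<le> j \<and> j \<le> r}
      \<or> P = {j * k | j. 1 \<le> j \<and> j + 2 \<le> r} \<union> {r * k} \<or> (P = {k, r} \<and> n \<ge> k + r)"
    using assms(3) by blast
  obtain A where A: "completion n (partial_toeplitz P t) A" "psd_mat A"
    using assms(4) by blast
  define K where "K i j = A $$ (i, j)" for i j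
  have car: "A \<in> carrier_mat n n"
    using A(1) by (simp add: completion_def)
  have psd: "psd_on {..<n} K"
    unfolding K_def using A(2) psd_mat_iff_psd_on[OF car] by blast
  have sym: "K j i = K i j" if "i < n" "j < n" for i j
  proof -
    have "A\<^sup>T $$ (i, j) = A $$ (i, j)"
      using A(1) by (simp add: completion_def symmetric_mat_def)
    then show ?thesis
      using car that by (simp add: K_def)
  qed
  have spec: "K i j = t (index_dist i j)"
    if "i < n" "j < n" "index_dist i j \<in> P \<union> {0}" for i j
    using A(1) that by (simp add: completion_def partial_toeplitz_def K_def)
  show ?thesis
  proof (cases "P = {k, r} \<and> n \<ge> k + r")
    case True
    then obtain s where "toeplitz_psd n s" "\<forall>d\<in>{0, k, r}. s d = t d"
      using two_diagonal_completion[OF psd sym spec, of k r] pos by blast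
    then show ?thesis
      using True by (intro toeplitz_completionI[of n s]) auto
  next
    case False
    then have P: "P = {j * k | j. 1 \<le> j \<and> j \<le> r}
        \<or> P = {j * k | j. 1 \<le> j \<and> j + 2 \<le> r} \<union> {r * k}"
      using cases by blast
    then have mem: "j * k \<in> P" if "1 \<le> j" "j + 2 \<le> r \<or> j = r" for j
      using that pos by auto
    \<comment> \<open>Since \<open>r * k\<close> lies in \<open>P\<close>, the indices
      \<open>0, k, ..., r * k\<close> fit into the matrix.\<close>
    have "r * k < n"
      using mem[of r] assms(1,2) pos by auto
    then obtain s where s: "toeplitz_psd (Suc r) s"
      and agree: "\<forall>j\<le>r. j * k \<in> P \<union> {0} \<longrightarrow> s j = t (j * k)"
      using multiples_completion[OF psd sym, of r k P t] pos spec mem by blast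
    show ?thesis
    proof (rule toeplitz_completion_of_multiples[OF pos(2) s])
      fix d assume d: "d \<in> P \<union> {0}"
      have "\<exists>j\<le>r. d = j * k"
      proof (cases "d = 0")
        case False
        with d obtain j where "d = j * k" "j \<le> r \<or> j + 2 \<le> r"
          using P by blast
        then show ?thesis
          by (intro exI[of _ j]) auto
      qed auto
      then show "\<exists>j\<le>r. d = j * k \<and> s j = t d"
        using agree d by blast
    qed
  qed
qed

end
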